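(* Fix $h,c,\mu>0$ and $r>1$ (convex delay costs). For $\lambda>0$ consider the problem $$\min_{s\in\mathbb{Z}_+,\ s>\lambda/\mu}\ \Pi_\lambda(s),\qquad \Pi_\lambda(s)=h\,\lambda\,\mathbb{E}[W_\lambda(s)^r]+c\,s,$$ where $W_\lambda(s)$ is the steady-state waiting time (time in queue) in the $M/M/s$ queue with arrival rate $\lambda$ and service rate $\mu$, and let $\Pi_\lambda^\star$ be its optimal value. Let $$\sigma^\star=\left(\frac{h}{c}\,r\,\Gamma(r+1)\,\mu^{1-r}\right)^{\frac{1}{r+1}},\qquad \bar s_\lambda=\frac{\lambda}{\mu}+\sigma^\star\left(\frac{\lambda}{\mu}\right)^{\frac{1}{r+1}},\qquad n_\lambda=\lambda^{\frac{3-r}{2(1+r)}}.$$ Then any staffing level $\bar s_\lambda+\eta_\lambda$ with $\eta_\lambda=o\left(\sqrt{n_\lambda\,\lambda^{\frac{1}{1+r}}}\right)$ as $\lambda\to\infty$ is $o(n_\lambda)$-optimal for this problem, i.e. $$\lim_{\lambda\to\infty}\frac{\Pi_\lambda(\bar s_\lambda+\eta_\lambda)-\Pi_\lambda^\star}{n_\lambda}=0.$$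
   Context: For real $s>\lambda/\mu$, with $\rho=\lambda/(s\mu)$, the moment and hence $\Pi_\lambda(s)$ are defined by $$\mathbb{E}[W_\lambda(s)^r]=\frac{\Gamma(r+1)}{(s\mu-\lambda)^r}\,B(\rho,s),\qquad B(\rho,s)=\left[s\rho\int_0^\infty t\,e^{-s\rho t}(1+t)^{s-1}\,dt\right]^{-1},$$ where for integer $s$, $B(\rho,s)$ is the Erlang-C probability that all $s$ servers are busy in steady state. The condition $s>\lambda/\mu$ is the stability condition. The optimality gap of a staffing level is the difference between the cost incurred when using it and the optimal cost; a staffing level $s_\lambda$ is $o(n_\lambda)$-optimal if its optimality gap is $o(n_\lambda)$, i.e. $\Pi_\lambda(s_\lambda)=\Pi_\lambda^\star+o(n_\lambda)$ as $\lambda\to\infty$. Here $f(\lambda)=o(g(\lambda))$ means $f(\lambda)/g(\lambda)\to0$ as $\lambda\to\infty$.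
   Formalization: The displayed limit is proved for r<5; for r≥5, where it fails because a fractional level can be cheaper than every integer one, it is proved along those λ at which the level is a feasible integer, and for all r>1 the cost exceeds the optimum by at most o(n_λ). *)

theory Defs
  imports "HOL-Analysis.Analysis" "HOL-Library.Landau_Symbols"
begin

text \<open>
  The continuous extension of the Erlang-C formula to real \<open>s\<close>, for utilisation \<open>\<rho> > 0\<close>.
  The integral converges whenever \<open>s * \<rho> > 0\<close>.
\<close>
definition erlang_C :: "real \<Rightarrow> real \<Rightarrow> real" where
  "erlang_C \<rho> s =
     inverse (s * \<rho> * (LBINT t:{0..}. t * exp (- (s * \<rho> * t)) * (1 + t) powr (s - 1)))"

text \<open>
  The \<open>r\<close>-th moment of the steady-state waiting time in queue, as a function of a real number
  \<open>s > lam / \<mu>\<close> of servers.  For \<open>s \<le> lam / \<mu>\<close> (no steady state) the value carries no meaning.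
\<close>
definition wait_moment :: "real \<Rightarrow> real \<Rightarrow> real \<Rightarrow> real \<Rightarrow> real" where
  "wait_moment \<mu> r lam s =
     Gamma (r + 1) / (s * \<mu> - lam) powr r * erlang_C (lam / (s * \<mu>)) s"

definition staffing_cost :: "real \<Rightarrow> real \<Rightarrow> real \<Rightarrow> real \<Rightarrow> real \<Rightarrow> real \<Rightarrow> real" where
  "staffing_cost h c \<mu> r lam s = h * lam * wait_moment \<mu> r lam s + c * s"

text \<open>The nonnegative integers satisfying the stability condition, embedded in the reals.\<close>
definition staffing_levels :: "real \<Rightarrow> real \<Rightarrow> real set" where
  "staffing_levels \<mu> lam = {s \<in> \<nat>. lam / \<mu> < s}"

definition optimal_cost :: "real \<Rightarrow> real \<Rightarrow> real \<Rightarrow> real \<Rightarrow> real \<Rightarrow> real" where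
  "optimal_cost h c \<mu> r lam = (INF s\<in>staffing_levels \<mu> lam. staffing_cost h c \<mu> r lam s)"

text \<open>
  The gap is nonnegative on \<open>staffing_levels\<close>.  At a non-integral \<open>s\<close> it can be negative, because
  the optimum is taken over integers only; the distance from a continuous to an integral minimiser
  costs an amount of order \<open>lam powr (-1 / (1 + r))\<close>, which is \<open>o(gap_scale r)\<close> exactly when
  \<open>r < 5\<close>.
\<close>
definition optimality_gap :: "real \<Rightarrow> real \<Rightarrow> real \<Rightarrow> real \<Rightarrow> real \<Rightarrow> real \<Rightarrow> real" where
  "optimality_gap h c \<mu> r lam s = staffing_cost h c \<mu> r lam s - optimal_cost h c \<mu> r lam"

definition sigma_star :: "real \<Rightarrow> real \<Rightarrow> real \<Rightarrow> real \<Rightarrow> real" where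
  "sigma_star h c \<mu> r = (h / c * r * Gamma (r + 1) * \<mu> powr (1 - r)) powr (1 / (r + 1))"

definition s_bar :: "real \<Rightarrow> real \<Rightarrow> real \<Rightarrow> real \<Rightarrow> real \<Rightarrow> real" where
  "s_bar h c \<mu> r lam = lam / \<mu> + sigma_star h c \<mu> r * (lam / \<mu>) powr (1 / (r + 1))"

definition gap_scale :: "real \<Rightarrow> real \<Rightarrow> real" where
  "gap_scale r lam = lam powr ((3 - r) / (2 * (1 + r)))"

text \<open>The infimum defining the optimal cost ranges over a nonempty set bounded below.\<close>

lemma erlang_C_nonneg:
  assumes "s * \<rho> \<ge> 0"
  shows "erlang_C \<rho> s \<ge> 0"
  unfolding erlang_C_def set_lebesgue_integral_def
  by (intro iffD2[OF inverse_nonnegative_iff_nonnegative] mult_nonneg_nonneg assms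
        Bochner_Integration.integral_nonneg)
     (auto simp: indicator_def)

lemma staffing_levels_nonempty: "staffing_levels \<mu> lam \<noteq> {}"
proof -
  obtain n :: nat where "lam / \<mu> < real n"
    using reals_Archimedean2 by blast
  then have "real n \<in> staffing_levels \<mu> lam"
    by (simp add: staffing_levels_def)
  then show ?thesis by blast
qed

lemma staffing_cost_nonneg:
  assumes "h > 0" "c > 0" "\<mu> > 0" "r > 1" "lam > 0" "lam / \<mu> < s"
  shows "staffing_cost h c \<mu> r lam s \<ge> 0"
proof -
  have "s > 0"
    using assms by (meson divide_pos_pos less_trans)
  then have "erlang_C (lam / (s * \<mu>)) s \<ge> 0"
    using assms by (intro erlang_C_nonneg) auto
  moreover have "Gamma (r + 1) > 0"
    using assms by (intro Gamma_real_pos) auto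
  ultimately show ?thesis
    using assms \<open>s > 0\<close>
    by (auto simp: staffing_cost_def wait_moment_def
        intro!: add_nonneg_nonneg mult_nonneg_nonneg divide_nonneg_nonneg)
qed

lemma bdd_below_staffing_cost:
  assumes "h > 0" "c > 0" "\<mu> > 0" "r > 1" "lam > 0"
  shows "bdd_below (staffing_cost h c \<mu> r lam ` staffing_levels \<mu> lam)"
  using staffing_cost_nonneg[OF assms] by (auto simp: bdd_below_def staffing_levels_def)

end

theory Submission
  imports Defs "HOL-Real_Asymp.Real_Asymp"
begin

text \<open>
  Let \<open>a = lam / \<mu>\<close> be the offered load and \<open>s = a + x\<close>.  Integration by parts (\<open>erlang_C_eq\<close>) gives
  \<open>erlang_C = 1 / (1 + x * J)\<close>, where \<open>J\<close> is the integral of \<open>exp (- (a * t)) * (1 + t) powr (a + x - 1)\<close>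
  over the half line.  If the probability of waiting were \<open>1\<close>, the cost would be
  \<open>c * a + K * a * x powr (- r) + c * x\<close> for a constant \<open>K\<close>, with minimizer
  \<open>y = sigma_star * a powr (1 / (r + 1))\<close>, and \<open>s_bar = a + y\<close>.  Because \<open>r > 1\<close>, \<open>y\<close> is small compared
  with \<open>sqrt a\<close>, and for \<open>x\<close> of order \<open>y\<close> dominated convergence (\<open>exp_powr_integral_asymptotics\<close>) shows
  that \<open>sqrt a * J\<close> tends to a constant \<open>k\<close> that does not depend on how \<open>x\<close> is chosen.

  The true cost differs from the simplified one by the delay cost saved by customers who need not wait.
  This saving is of order \<open>y * (y / sqrt a)\<close>, which is the gap scale itself, so it cannot be neglected:
  optimality up to \<open>o(gap_scale)\<close> requires its leading coefficient.  In units \<open>u = x / y\<close> and with the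
  small parameter \<open>w = y / sqrt a\<close>, the cost becomes
  \<open>c * a + c * y * (u powr (- r) / r * C + u)\<close> with \<open>C = 1 / (1 + u * w * e)\<close> and \<open>e\<close> tending to \<open>k\<close>.

  Two expansions with the same first-order term \<open>- k / r * w\<close> settle the matter.  From below, for every
  staffing level simultaneously, the bracket is at least
  \<open>(1 + 1 / r) * (1 - j) powr (1 / (r + 1))\<close> with \<open>j\<close> asymptotically \<open>k * w\<close>
  (\<open>busy_delay_plus_staffing_ge\<close>, \<open>optimal_cost_expansion_ge\<close>).  At \<open>s_bar + \<eta>\<close> the bracket is
  \<open>1 + 1 / r - k / r * w + o(w)\<close>, because the displacement enters quadratically and the hypothesis on
  \<open>\<eta>\<close> says that \<open>(\<eta> / y)\<^sup>2 = o(w)\<close> (\<open>staffing_cost_expansion\<close>).  Hence the positive part of the gap is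
  \<open>o(gap_scale)\<close>; at admissible levels the gap is nonnegative, so this is the whole gap.  For \<open>r < 5\<close>
  a bounded \<open>\<eta>\<close> satisfies the hypothesis, so rounding \<open>s_bar\<close> up to an integer yields a matching upper
  bound on the optimal cost, and the gap is also bounded from below.
\<close>

section \<open>The Erlang C formula as a single integral\<close>

text \<open>
  The integral in the Erlang C formula, without its factor \<open>t\<close>.  Dropping that factor
  leaves an integral that is monotone in the exponent and has a clean Laplace limit.
\<close>
definition exp_powr_integral :: "real \<Rightarrow> real \<Rightarrow> real" where
  "exp_powr_integral a q = (LBINT t:{0..}. exp (- (a * t)) * (1 + t) powr q)"

lemma set_integrable_exp:
  fixes b :: real assumes "b > 0"
  shows "set_integrable lborel {0..} (\<lambda>t. exp (- (b * t)))"
proof -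
  have "(\<lambda>t. exp (- b * t)) absolutely_integrable_on {0..}"
    using integrable_on_exp_minus_to_infinity[OF assms, of 0]
    by (intro nonnegative_absolutely_integrable_1) auto
  then show ?thesis
    unfolding set_integrable_def by (subst (asm) integrable_completion) auto
qed

text \<open>
  Half of the exponential decay is spent on the power: the tangent of \<open>ln\<close> at a point \<open>K\<close> proportional
  to \<open>p / a\<close> bounds \<open>p * ln (1 + t)\<close> by \<open>a / 2 * t\<close> plus a constant.
\<close>
lemma set_integrable_exp_powr:
  fixes a q :: real
  assumes "a > 0"
  shows "set_integrable lborel {0..} (\<lambda>t. exp (- (a * t)) * (1 + t) powr q)"
proof -
  (* A positive exponent above q makes the tangent point K positive. *)
  define p where "p = max q 1"
  define K where "K = 2 * p / a"
  define M where "M = exp (p * (ln K - 1) + a / 2)"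
  have p: "p > 0" "q \<le> p" by (auto simp: p_def)
  have K: "K > 0" "p / K = a / 2" using assms p by (auto simp: K_def)
  have bound: "exp (- (a * t)) * (1 + t) powr q \<le> M * exp (- (a / 2 * t))" if "t \<ge> 0" for t
  proof -
    have "ln (1 + t) = ln ((1 + t) / K) + ln K"
      using that K by (simp add: ln_div)
    also have "\<dots> \<le> (1 + t) / K - 1 + ln K"
      using ln_le_minus_one[of "(1 + t) / K"] that K by simp
    finally have "p * ln (1 + t) \<le> p * ((1 + t) / K - 1 + ln K)"
      using p by (intro mult_left_mono) auto
    also have "\<dots> = a / 2 * (1 + t) + p * (ln K - 1)"
      unfolding K(2)[symmetric] by (simp add: algebra_simps)
    finally have "(1 + t) powr p \<le> M * exp (a / 2 * t)"
      using that by (simp add: powr_def M_def mult_exp_exp algebra_simps add_divide_distrib)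
    moreover have "(1 + t) powr q \<le> (1 + t) powr p"
      using that p by (intro powr_mono) auto
    ultimately have "exp (- (a * t)) * (1 + t) powr q \<le> exp (- (a * t)) * (M * exp (a / 2 * t))"
      by (intro mult_left_mono) auto
    also have "\<dots> = M * exp (- (a / 2 * t))"
      by (simp add: mult_exp_exp algebra_simps)
    finally show ?thesis .
  qed
  show ?thesis
  proof (rule set_integrable_bound)
    show "set_integrable lborel {0..} (\<lambda>t. M * exp (- (a / 2 * t)))"
      using set_integrable_exp[of "a / 2"] assms by simp
    show "set_borel_measurable lborel {0..} (\<lambda>t. exp (- (a * t)) * (1 + t) powr q)"
      unfolding set_borel_measurable_def by measurable
    show "AE t in lborel. t \<in> {0..} \<longrightarrow> norm (exp (- (a * t)) * (1 + t) powr q)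
       \<le> norm (M * exp (- (a / 2 * t)))"
      using bound by (auto simp: M_def abs_mult)
  qed
qed

lemma exp_powr_integral_nonneg: "exp_powr_integral a q \<ge> 0"
  unfolding exp_powr_integral_def set_lebesgue_integral_def
  by (intro Bochner_Integration.integral_nonneg) auto

lemma exp_powr_integral_mono:
  assumes "a > 0" "q \<le> q'"
  shows "exp_powr_integral a q \<le> exp_powr_integral a q'"
  unfolding exp_powr_integral_def using assms
  by (intro set_integral_mono set_integrable_exp_powr mult_left_mono powr_mono) auto

text \<open>Integration by parts: the boundary term of \<open>exp (- (a * t)) * (1 + t) powr q\<close> contributes the \<open>1\<close>.\<close>
lemma exp_powr_integral_recurrence:
  assumes "a > 0"
  shows "a * exp_powr_integral a q = 1 + q * exp_powr_integral a (q - 1)"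
proof -
  define F where "F = (\<lambda>t::real. exp (- (a * t)) * (1 + t) powr q)"
  define f where "f = (\<lambda>t::real. q * (exp (- (a * t)) * (1 + t) powr (q - 1)) - a * (exp (- (a * t)) * (1 + t) powr q))"
  have int: "set_integrable lborel {0..} f"
    unfolding f_def using assms by (intro set_integral_diff set_integrable_mult_right set_integrable_exp_powr)
  have FTC: "set_lebesgue_integral lborel {0..b} f = F b - F 0" if "b \<ge> 0" for b
    unfolding set_lebesgue_integral_def
  proof (rule integral_FTC_atLeastAtMost[OF that])
    fix t :: real assume "0 \<le> t" "t \<le> b"
    then have "(F has_real_derivative f t) (at t within {0..b})"
      unfolding F_def f_def by (auto intro!: derivative_eq_intros simp: powr_diff field_simps)
    then show "(F has_vector_derivative f t) (at t within {0..b})"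
      by (simp add: has_real_derivative_iff_has_vector_derivative)
  next
    show "continuous_on {0..b} f"
      unfolding f_def by (intro continuous_intros) auto
  qed
  have "(F \<longlongrightarrow> 0) at_top"
    unfolding F_def using assms by real_asymp
  then have "((\<lambda>b. F b - F 0) \<longlongrightarrow> 0 - F 0) at_top"
    by (intro tendsto_intros)
  then have "((\<lambda>b. set_lebesgue_integral lborel {0..b} f) \<longlongrightarrow> 0 - F 0) at_top"
    by (rule Lim_transform_eventually) (use eventually_ge_at_top[of 0] in eventually_elim, simp add: FTC)
  moreover have "((\<lambda>b. set_lebesgue_integral lborel {0..b} f) \<longlongrightarrow> set_lebesgue_integral lborel {0..} f) at_top"
    using int by (intro tendsto_set_lebesgue_integral_at_top) auto
  ultimately have "set_lebesgue_integral lborel {0..} f = 0 - F 0"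
    by (intro tendsto_unique[OF trivial_limit_at_top_linorder])
  then have "set_lebesgue_integral lborel {0..} f = - 1"
    by (simp add: F_def)
  moreover have "set_lebesgue_integral lborel {0..} f = q * exp_powr_integral a (q - 1) - a * exp_powr_integral a q"
    unfolding f_def exp_powr_integral_def using assms
    by (simp add: set_integral_diff set_integrable_exp_powr)
  ultimately show ?thesis by simp
qed

text \<open>
  Since \<open>t * (1 + t) powr (s - 1)\<close> is \<open>(1 + t) powr s - (1 + t) powr (s - 1)\<close>, the recurrence
  eliminates the factor \<open>t\<close>.  In this form the probability \<open>1 - erlang_C\<close> of not having to
  wait is visibly of the order of the excess capacity \<open>x\<close> times the integral, and \<open>1 / (1 + v) \<ge> 1 - v\<close> bounds it from above.
\<close>
lemma erlang_C_eq:
  assumes "a > 0" "s * \<rho> = a" "s = a + x"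
  shows "erlang_C \<rho> s = 1 / (1 + x * exp_powr_integral a (a + x - 1))"
proof -
  have "(LBINT t:{0..}. t * exp (- (a * t)) * (1 + t) powr (s - 1))
    = (LBINT t:{0..}. exp (- (a * t)) * (1 + t) powr s - exp (- (a * t)) * (1 + t) powr (s - 1))"
    by (intro set_lebesgue_integral_cong) (auto simp: powr_diff field_simps)
  also have "\<dots> = exp_powr_integral a s - exp_powr_integral a (s - 1)"
    unfolding exp_powr_integral_def using assms
    by (simp add: set_integral_diff set_integrable_exp_powr)
  finally have "erlang_C \<rho> s = inverse (a * (exp_powr_integral a s - exp_powr_integral a (s - 1)))"
    unfolding erlang_C_def assms(2) by simp
  also have "a * (exp_powr_integral a s - exp_powr_integral a (s - 1)) = 1 + x * exp_powr_integral a (s - 1)"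
    using exp_powr_integral_recurrence[OF assms(1), of s] assms(3) by (simp add: algebra_simps)
  finally show ?thesis
    by (simp add: assms(3) inverse_eq_divide)
qed

section \<open>Laplace asymptotics at the square root scale\<close>

text \<open>The mass of the integrand sits at \<open>t\<close> of order \<open>1 / sqrt a\<close>, hence the substitution \<open>t = v / sqrt a\<close>.\<close>
lemma exp_powr_integral_scaled:
  assumes "a > 0"
  shows "sqrt a * exp_powr_integral a q =
    (\<integral>v. indicator {0..} v * exp (q * ln (1 + v / sqrt a) - sqrt a * v) \<partial>lborel)"
proof -
  have "exp_powr_integral a q = \<bar>1 / sqrt a\<bar> *\<^sub>R
     (\<integral>v. indicator {0..} (0 + 1 / sqrt a * v) *\<^sub>R
        (exp (- (a * (0 + 1 / sqrt a * v))) * (1 + (0 + 1 / sqrt a * v)) powr q) \<partial>lborel)"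
    unfolding exp_powr_integral_def set_lebesgue_integral_def using assms
    by (intro lborel_integral_real_affine) auto
  then have "sqrt a * exp_powr_integral a q = 
     (\<integral>v. indicator {0..} (0 + 1 / sqrt a * v) *\<^sub>R
        (exp (- (a * (0 + 1 / sqrt a * v))) * (1 + (0 + 1 / sqrt a * v)) powr q) \<partial>lborel)"
    using assms by simp
  also have "\<dots> = (\<integral>v. indicator {0..} v * exp (q * ln (1 + v / sqrt a) - sqrt a * v) \<partial>lborel)"
  proof (intro Bochner_Integration.integral_cong refl)
    fix v :: real
    have "indicator {0..} (0 + 1 / sqrt a * v) = (indicator {0..} v :: real)"
      using assms by (auto simp: indicator_def zero_le_divide_iff)
    moreover have "exp (- (a * (0 + 1 / sqrt a * v))) * (1 + (0 + 1 / sqrt a * v)) powr q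
        = exp (q * ln (1 + v / sqrt a) - sqrt a * v)" if "v \<ge> 0"
    proof -
      have "1 + v / sqrt a > 0" using assms that by (simp add: add_pos_nonneg)
      moreover have "a * (v / sqrt a) = sqrt a * v"
        using assms by (simp add: real_div_sqrt field_simps)
      ultimately show ?thesis
        by (simp add: powr_def mult_exp_exp)
    qed
    ultimately show "indicator {0..} (0 + 1 / sqrt a * v) *\<^sub>R
        (exp (- (a * (0 + 1 / sqrt a * v))) * (1 + (0 + 1 / sqrt a * v)) powr q)
        = indicator {0..} v * exp (q * ln (1 + v / sqrt a) - sqrt a * v)"
      by (cases "v \<ge> 0") auto
  qed
  finally show ?thesis .
qed

lemma ln_le_half_minus_inverse:
  fixes y :: real
  assumes "y \<ge> 1"
  shows "ln y \<le> (y - inverse y) / 2"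
proof -
  define g where "g = (\<lambda>y::real. (y - inverse y) / 2 - ln y)"
  have "g 1 \<le> g y"
  proof (rule DERIV_nonneg_imp_nondecreasing[OF assms])
    fix x :: real assume x: "1 \<le> x" "x \<le> y"
    have "(g has_real_derivative (1 - inverse x)\<^sup>2 / 2) (at x)"
      unfolding g_def using x
      by (auto intro!: derivative_eq_intros simp: field_simps power2_eq_square)
    then show "\<exists>d. (g has_real_derivative d) (at x) \<and> 0 \<le> d"
      by (intro exI[of _ "(1 - inverse x)\<^sup>2 / 2"]) auto
  qed
  then show ?thesis by (simp add: g_def)
qed

text \<open>
  The quadratic bound on \<open>ln (1 + w) - w\<close> at \<open>w = v / sqrt a\<close> is weakened to a linear one that is
  independent of \<open>a\<close>: this is the integrable majorant for dominated convergence.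
\<close>
lemma scaled_log_le:
  fixes a v :: real
  assumes "a \<ge> 1" "v \<ge> 0"
  shows "a * (ln (1 + v / sqrt a) - v / sqrt a) \<le> (1 - v) / 2"
proof -
  define w where "w = v / sqrt a"
  have w: "w \<ge> 0" "a * w\<^sup>2 = v\<^sup>2" "w \<le> v"
    using assms mult_right_mono[of 1 "sqrt a" v] by (auto simp: w_def power_divide divide_le_eq mult.commute)
  have "ln (1 + w) - w \<le> - (w\<^sup>2 / (2 * (1 + w)))"
    using ln_le_half_minus_inverse[of "1 + w"] w by (simp add: field_simps power2_eq_square)
  then have "a * (ln (1 + w) - w) \<le> a * - (w\<^sup>2 / (2 * (1 + w)))"
    using assms by (intro mult_left_mono) auto
  also have "\<dots> = - (v\<^sup>2 / (2 * (1 + w)))"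
    using w by (simp flip: w(2))
  also have "\<dots> \<le> - (v\<^sup>2 / (2 * (1 + v)))"
    using w assms by (auto intro!: divide_left_mono)
  also have "\<dots> \<le> (1 - v) / 2"
    using assms by (simp add: field_simps power2_eq_square)
  finally show ?thesis by (simp add: w_def)
qed

lemma scaled_log_tendsto:
  fixes v :: real assumes "v > 0"
  shows "((\<lambda>a. a * (ln (1 + v / sqrt a) - v / sqrt a)) \<longlongrightarrow> - (v\<^sup>2 / 2)) at_top"
  using assms by (real_asymp simp: field_simps power2_eq_square)

text \<open>This is \<open>sqrt (pi / 2)\<close>, the limit of the rescaled integral; it cancels in the optimality gap.\<close>
definition gauss_const :: real where
  "gauss_const = (LBINT v:{0..}. exp (- (v\<^sup>2 / 2)))"

text \<open>
  After rescaling, the logarithm of the integrand splits into \<open>A * (ln (1 + w) - w)\<close> with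
  \<open>w = v / sqrt A\<close>, which tends to \<open>- v\<^sup>2 / 2\<close>, and \<open>(X - 1) * ln (1 + w)\<close>, which vanishes because \<open>X\<close>
  is small compared with \<open>sqrt A\<close>.  Hence excess capacities that differ, but are both below the square
  root scale, share the same limit.
\<close>
lemma exp_powr_integral_asymptotics:
  fixes A X :: "real \<Rightarrow> real"
  assumes A: "filterlim A at_top at_top"
    and X: "((\<lambda>l. X l / sqrt (A l)) \<longlongrightarrow> 0) at_top"
  shows "((\<lambda>l. sqrt (A l) * exp_powr_integral (A l) (A l + X l - 1)) \<longlongrightarrow>
           gauss_const) at_top"
proof -
  define s where "s = (\<lambda>l v. indicator {0..} v *
     exp ((A l + X l - 1) * ln (1 + v / sqrt (A l)) - sqrt (A l) * v))"
  have Apos: "eventually (\<lambda>l. A l \<ge> 1) at_top"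
    using A by (simp add: filterlim_at_top)
  have inv: "((\<lambda>l. 1 / sqrt (A l)) \<longlongrightarrow> 0) at_top"
    by (rule filterlim_compose[OF _ A]) real_asymp
  have "((\<lambda>l. X l / sqrt (A l) - 1 / sqrt (A l)) \<longlongrightarrow> 0 - 0) at_top"
    by (intro tendsto_intros X inv)
  then have X1: "((\<lambda>l. (X l - 1) / sqrt (A l)) \<longlongrightarrow> 0) at_top"
    by (simp add: diff_divide_distrib)
  have split: "(A l + X l - 1) * ln (1 + v / sqrt (A l)) - sqrt (A l) * v =
     A l * (ln (1 + v / sqrt (A l)) - v / sqrt (A l)) + (X l - 1) * ln (1 + v / sqrt (A l))"
    if "A l \<ge> 1" for l v
  proof -
    have "A l * (v / sqrt (A l)) = sqrt (A l) * v"
      using that by (simp add: real_div_sqrt field_simps)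
    then show ?thesis by (simp add: algebra_simps)
  qed
  have corr: "\<bar>(X l - 1) * ln (1 + v / sqrt (A l))\<bar> \<le> \<bar>(X l - 1) / sqrt (A l)\<bar> * v"
    if "A l \<ge> 1" "v \<ge> 0" for l v
  proof -
    have "v / sqrt (A l) \<ge> 0" using that by simp
    then have "\<bar>ln (1 + v / sqrt (A l))\<bar> \<le> v / sqrt (A l)"
      using ln_add_one_self_le_self[of "v / sqrt (A l)"] by (simp add: ln_ge_zero)
    then have "\<bar>X l - 1\<bar> * \<bar>ln (1 + v / sqrt (A l))\<bar> \<le> \<bar>X l - 1\<bar> * (v / sqrt (A l))"
      by (intro mult_left_mono) auto
    then show ?thesis using that by (simp add: abs_mult)
  qed
  have lim: "((\<lambda>l. s l v) \<longlongrightarrow> indicator {0..} v * exp (- (v\<^sup>2 / 2))) at_top" for v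
  proof (cases "v > 0")
    case True
    have "((\<lambda>l. (X l - 1) * ln (1 + v / sqrt (A l))) \<longlongrightarrow> 0) at_top"
    proof (rule Lim_null_comparison)
      show "eventually (\<lambda>l. norm ((X l - 1) * ln (1 + v / sqrt (A l))) \<le> \<bar>(X l - 1) / sqrt (A l)\<bar> * v) at_top"
        using Apos by eventually_elim (use corr True in auto)
      show "((\<lambda>l. \<bar>(X l - 1) / sqrt (A l)\<bar> * v) \<longlongrightarrow> 0) at_top"
        using tendsto_mult[OF tendsto_rabs[OF X1] tendsto_const[of v]] by simp
    qed
    with filterlim_compose[OF scaled_log_tendsto[OF True] A]
    have "((\<lambda>l. A l * (ln (1 + v / sqrt (A l)) - v / sqrt (A l)) + (X l - 1) * ln (1 + v / sqrt (A l)))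
       \<longlongrightarrow> - (v\<^sup>2 / 2) + 0) at_top"
      by (rule tendsto_add)
    then have "((\<lambda>l. (A l + X l - 1) * ln (1 + v / sqrt (A l)) - sqrt (A l) * v) \<longlongrightarrow> - (v\<^sup>2 / 2)) at_top"
      unfolding add_0_right
      by (rule Lim_transform_eventually) (use Apos in eventually_elim, simp add: split)
    then show ?thesis
      unfolding s_def by (intro tendsto_intros)
  next
    case False
    then show ?thesis by (cases "v = 0") (auto simp: s_def)
  qed
  have "((\<lambda>l. integral\<^sup>L lborel (s l)) \<longlongrightarrow> (\<integral>v. indicator {0..} v * exp (- (v\<^sup>2 / 2)) \<partial>lborel)) at_top"
  proof (rule integral_dominated_convergence_at_top)
    show "integrable lborel (\<lambda>v::real. exp (1 / 2) * (indicator {0..} v * exp (- (1 / 4 * v))))"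
      using set_integrable_exp[of "1 / 4"] unfolding set_integrable_def by simp
    (* The main part decays like exp (- v / 2); the perturbation may use up half of that rate. *)
    have "eventually (\<lambda>l. \<bar>(X l - 1) / sqrt (A l)\<bar> < 1 / 4) at_top"
      using order_tendstoD(2)[OF tendsto_rabs[OF X1], of "1/4"] by simp
    with Apos show "eventually (\<lambda>l. AE v in lborel. norm (s l v) \<le> exp (1 / 2) * (indicator {0..} v * exp (- (1 / 4 * v)))) at_top"
    proof eventually_elim
      case (elim l)
      have "norm (s l v) \<le> exp (1 / 2) * (indicator {0..} v * exp (- (1 / 4 * v)))" for v
      proof (cases "v \<ge> 0")
        case True
        have "\<bar>(X l - 1) / sqrt (A l)\<bar> * v \<le> 1 / 4 * v"
          using elim True by (intro mult_right_mono) auto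
        then have "(X l - 1) * ln (1 + v / sqrt (A l)) \<le> 1 / 4 * v"
          using corr[OF elim(1) True] by (meson abs_ge_self order_trans)
        with scaled_log_le[OF elim(1) True]
        have "(A l + X l - 1) * ln (1 + v / sqrt (A l)) - sqrt (A l) * v \<le> (1 - v) / 2 + 1 / 4 * v"
          unfolding split[OF elim(1)] by (rule add_mono)
        also have "\<dots> = 1 / 2 + (- (1 / 4 * v))" by (simp add: field_simps)
        finally have "(A l + X l - 1) * ln (1 + v / sqrt (A l)) - sqrt (A l) * v \<le> 1 / 2 + (- (1 / 4 * v))" .
        then have "exp ((A l + X l - 1) * ln (1 + v / sqrt (A l)) - sqrt (A l) * v) \<le> exp (1 / 2) * exp (- (1 / 4 * v))"
          unfolding mult_exp_exp by simp
        then show ?thesis using True by (simp add: s_def)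
      qed (simp add: s_def)
      then show ?case by simp
    qed
  qed (use lim in \<open>auto simp: s_def\<close>)
  moreover have "eventually (\<lambda>l. integral\<^sup>L lborel (s l) = sqrt (A l) * exp_powr_integral (A l) (A l + X l - 1)) at_top"
    using Apos by eventually_elim (simp add: s_def exp_powr_integral_scaled)
  ultimately show ?thesis
    unfolding gauss_const_def set_lebesgue_integral_def by (auto intro: Lim_transform_eventually)
qed

section \<open>The normalized cost\<close>
text \<open>Tangent line of the convex function \<open>u powr (- r)\<close> at \<open>w\<close>, reduced to \<open>exp x \<ge> 1 + x\<close> by scaling.\<close>
lemma powr_tangent_le:
  fixes u w r :: real
  assumes "u > 0" "w > 0" "r > 0"
  shows "w powr (- r) - r * w powr (- r - 1) * (u - w) \<le> u powr (- r)"
proof -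
  have "r * ln (u / w) \<le> r * (u / w - 1)"
    using assms by (intro mult_left_mono ln_le_minus_one) auto
  then have "1 - r * (u / w - 1) \<le> 1 + (- r * ln (u / w))" by simp
  also have "\<dots> \<le> (u / w) powr (- r)"
    using exp_ge_add_one_self[of "- r * ln (u / w)"] assms by (simp add: powr_def)
  finally have "w powr (- r) * (1 - r * (u / w - 1)) \<le> w powr (- r) * (u / w) powr (- r)"
    by (intro mult_left_mono) auto
  also have "w powr (- r) * (u / w) powr (- r) = u powr (- r)"
    using assms by (simp add: powr_mult[symmetric])
  finally show ?thesis
    using assms by (simp add: powr_diff field_simps)
qed

text \<open>
  With \<open>u\<close> the excess capacity measured in units of \<open>fluid_excess\<close> below, \<open>u powr (- r) / r + u\<close> is the
  cost in excess of the offered load when every customer waits.  Weighting the delay by \<open>\<alpha>\<close> moves the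
  minimizer from \<open>1\<close> to \<open>w = \<alpha> powr (1 / (r + 1))\<close>; the tangent of the delay term at \<open>w\<close> has slope
  \<open>- 1\<close> and cancels the linear term.
\<close>
lemma weighted_delay_plus_staffing_ge:
  fixes u r \<alpha> :: real
  assumes "u > 0" "r > 0" "\<alpha> > 0"
  shows "(1 + 1 / r) * \<alpha> powr (1 / (r + 1)) \<le> \<alpha> * u powr (- r) / r + u"
proof -
  define w where "w = \<alpha> powr (1 / (r + 1))"
  have w: "w > 0" "\<alpha> = w powr (r + 1)"
    using assms by (auto simp: w_def powr_powr)
  have "\<alpha> * (w powr (- r) - r * w powr (- r - 1) * (u - w)) \<le> \<alpha> * u powr (- r)"
    using assms w by (intro mult_left_mono powr_tangent_le) auto
  moreover have "\<alpha> * w powr (- r) = w" "\<alpha> * w powr (- r - 1) = 1"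
    using w by (simp_all add: powr_add[symmetric])
  ultimately have "w - r * (u - w) \<le> \<alpha> * u powr (- r)"
    by (simp add: right_diff_distrib mult.assoc[symmetric] mult.commute[of \<alpha> r]) 
       (metis mult.assoc mult.right_neutral)
  then have "(w - r * (u - w)) / r \<le> \<alpha> * u powr (- r) / r"
    using assms by (intro divide_right_mono) auto
  moreover have "(w - r * (u - w)) / r = (1 + 1 / r) * w - u"
    using assms by (simp add: field_simps)
  ultimately show ?thesis by (simp add: w_def)
qed

text \<open>
  The excess over the minimum is at most the slope at \<open>u\<close> times the displacement, by convexity.  The
  slope \<open>1 - u powr (- r - 1)\<close> vanishes at \<open>1\<close>, so the excess is of second order in \<open>u - 1\<close>.
\<close>
lemma delay_plus_staffing_quadratic:
  fixes u r :: real
  assumes "u > 0" "r > 0"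
  shows "u powr (- r) / r + u - (1 + 1 / r) \<ge> 0"
    and "u powr (- r) / r + u - (1 + 1 / r) \<le> (u - 1) * (1 - u powr (- r - 1))"
proof -
  show "u powr (- r) / r + u - (1 + 1 / r) \<ge> 0"
    using weighted_delay_plus_staffing_ge[of u r 1] assms by simp
  have "u powr (- r) - r * u powr (- r - 1) * (1 - u) \<le> 1"
    using powr_tangent_le[of 1 u r] assms by simp
  then have "(u powr (- r) - r * u powr (- r - 1) * (1 - u)) / r \<le> 1 / r"
    using assms by (intro divide_right_mono) auto
  moreover have "(u powr (- r) - r * u powr (- r - 1) * (1 - u)) / r = u powr (- r) / r - u powr (- r - 1) * (1 - u)"
    using assms by (simp add: diff_divide_distrib)
  ultimately show "u powr (- r) / r + u - (1 + 1 / r) \<le> (u - 1) * (1 - u powr (- r - 1))"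
    by (simp add: algebra_simps)
qed

text \<open>
  The lower bound that survives when the delay is discounted by the probability \<open>C\<close> of waiting.  Below
  \<open>u = 1\<close> the discount is at least \<open>1 - j\<close> and the weighted minimum applies.  Between \<open>1\<close> and \<open>2\<close>
  the saving \<open>j * u powr (1 - r) / r\<close> is at most \<open>j / r\<close>, because \<open>r > 1\<close>.  Beyond \<open>2\<close> the staffing
  cost alone exceeds \<open>1 + 1 / r\<close>.
\<close>
lemma busy_delay_plus_staffing_ge:
  fixes u r j C :: real
  assumes "u > 0" "r > 1" "0 \<le> j" "j < 1" "C \<ge> 0" and C: "u \<le> 2 \<Longrightarrow> C \<ge> 1 - u * j"
  shows "(1 + 1 / r) * (1 - j) powr (1 / (r + 1)) \<le> u powr (- r) / r * C + u"
proof -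
  consider "u \<le> 1" | "1 < u" "u \<le> 2" | "u > 2" by linarith
  then show ?thesis
  proof cases
    case 1
    then have "1 - j \<le> C"
      using C mult_right_mono[of u 1 j] assms by simp
    then have "u powr (- r) / r * (1 - j) \<le> u powr (- r) / r * C"
      using assms by (intro mult_left_mono) auto
    then show ?thesis
      using weighted_delay_plus_staffing_ge[of u r "1 - j"] assms by (simp add: mult.commute)
  next
    case 2
    have "u powr (- r) * u = u powr (1 - r)"
      using assms powr_add[of u "- r" 1] by simp
    then have le1: "u powr (- r) * u \<le> 1"
      using 2 assms powr_mono[of "1 - r" 0 u] by simp
    have "u powr (- r) - j \<le> u powr (- r) - u powr (- r) * u * j"
      using mult_right_mono[OF le1 assms(3)] by simp
    also have "\<dots> = u powr (- r) * (1 - u * j)" by (simp add: algebra_simps)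
    also have "\<dots> \<le> u powr (- r) * C"
      using C 2 by (intro mult_left_mono) auto
    finally have "(u powr (- r) - j) / r \<le> u powr (- r) * C / r"
      using assms by (intro divide_right_mono) auto
    then show ?thesis
      using delay_plus_staffing_quadratic(1)[of u r] weighted_delay_plus_staffing_ge[of 1 r "1 - j"] assms
      by (simp add: diff_divide_distrib)
  next
    case 3
    have "(1 - j) powr (1 / (r + 1)) \<le> 1"
      using assms by (simp add: powr_le1)
    then have "(1 + 1 / r) * (1 - j) powr (1 / (r + 1)) \<le> (1 + 1 / r) * 1"
      using assms by (intro mult_left_mono) auto
    also have "\<dots> \<le> 2" using assms by simp
    also have "\<dots> \<le> u powr (- r) / r * C + u"
      using 3 assms by (simp add: add_increasing)
    finally show ?thesis .
  qed
qed

text \<open>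
  Caratheodory's form of the derivative lets \<open>z' l\<close> return to \<open>z\<close>, where the difference quotient of
  \<open>f\<close> would be undefined.
\<close>
lemma tendsto_increment_quotient:
  fixes f :: "real \<Rightarrow> real"
  assumes "(f has_real_derivative D) (at z)" "(z' \<longlongrightarrow> z) F" "((\<lambda>l. (z' l - z) / w l) \<longlongrightarrow> k) F"
  shows "((\<lambda>l. (f (z' l) - f z) / w l) \<longlongrightarrow> D * k) F"
proof -
  obtain g where g: "\<And>v. f v - f z = g v * (v - z)" "isCont g z" "g z = D"
    using assms(1) unfolding CARAT_DERIV by blast
  have "((\<lambda>l. g (z' l) * ((z' l - z) / w l)) \<longlongrightarrow> g z * k) F"
    by (intro tendsto_intros isCont_tendsto_compose[OF g(2)] assms)
  then show ?thesis by (simp add: g)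
qed

text \<open>
  The lower bound above with \<open>j = w * e\<close>, to first order in \<open>w\<close>: the factor \<open>1 + 1 / r = (r + 1) / r\<close>
  cancels the exponent \<open>1 / (r + 1)\<close>.
\<close>
lemma relaxed_minimum_expansion:
  fixes w e :: "real \<Rightarrow> real"
  assumes "r > 0" "(w \<longlongrightarrow> 0) F" "(e \<longlongrightarrow> k) F" "eventually (\<lambda>l. w l > 0) F"
  shows "((\<lambda>l. ((1 + 1 / r) * (1 - w l * e l) powr (1 / (r + 1)) - (1 + 1 / r)) / w l) \<longlongrightarrow> - k / r) F"
proof -
  define f where "f = (\<lambda>z::real. (1 + 1 / r) * (1 - z) powr (1 / (r + 1)))"
  have "(1 + 1 / r) * (1 / (r + 1)) = 1 / r"
    using assms by (simp add: field_simps)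
  then have "(f has_real_derivative - (1 / r)) (at 0)"
    unfolding f_def by (auto intro!: derivative_eq_intros)
  moreover have "((\<lambda>l. w l * e l) \<longlongrightarrow> 0) F"
    using tendsto_mult[OF assms(2,3)] by simp
  moreover have "((\<lambda>l. (w l * e l - 0) / w l) \<longlongrightarrow> k) F"
    using assms(3) by (rule Lim_transform_eventually) (use assms(4) in eventually_elim, simp)
  ultimately have "((\<lambda>l. (f (w l * e l) - f 0) / w l) \<longlongrightarrow> - (1 / r) * k) F"
    by (rule tendsto_increment_quotient)
  then show ?thesis by (simp add: f_def)
qed

text \<open>
  Close to \<open>u = 1\<close> the normalized cost has the same first-order term as its lower bound.  This is an
  envelope effect: to first order in \<open>w\<close>, evaluating the discount at the undiscounted minimizer already
  gives the discounted minimum, and moving \<open>u\<close> away from \<open>1\<close> costs only \<open>(u - 1)\<^sup>2\<close>, which is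
  \<open>o(w)\<close> by assumption.
\<close>
lemma normalized_cost_expansion:
  fixes u w e :: "real \<Rightarrow> real"
  assumes r: "r > 0" and w: "(w \<longlongrightarrow> 0) F" and e: "(e \<longlongrightarrow> k) F" and wpos: "eventually (\<lambda>l. w l > 0) F"
    and u: "(u \<longlongrightarrow> 1) F" and quad: "((\<lambda>l. (u l - 1)\<^sup>2 / w l) \<longlongrightarrow> 0) F"
  shows "((\<lambda>l. (u l powr (- r) / r * (1 / (1 + u l * w l * e l)) + u l - (1 + 1 / r)) / w l) \<longlongrightarrow> - k / r) F"
proof -
  obtain g where g: "\<And>v. 1 - v powr (- r - 1) = g v * (v - 1)" "isCont g 1"
  proof -
    have "((\<lambda>v. 1 - v powr (- r - 1)) has_real_derivative (r + 1)) (at 1)"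
      by (auto intro!: derivative_eq_intros)
    then show ?thesis unfolding CARAT_DERIV using that by auto
  qed
  have upos: "eventually (\<lambda>l. u l > 0) F"
    using order_tendstoD(1)[OF u, of 0] by simp
  have excess: "((\<lambda>l. (u l powr (- r) / r + u l - (1 + 1 / r)) / w l) \<longlongrightarrow> 0) F"
  proof (rule tendsto_sandwich)
    show "eventually (\<lambda>l. 0 \<le> (u l powr (- r) / r + u l - (1 + 1 / r)) / w l) F"
      using upos wpos by eventually_elim (use r in \<open>intro divide_nonneg_pos delay_plus_staffing_quadratic\<close>)
    show "eventually (\<lambda>l. (u l powr (- r) / r + u l - (1 + 1 / r)) / w l \<le> g (u l) * ((u l - 1)\<^sup>2 / w l)) F"
      using upos wpos
    proof eventually_elim
      case (elim l)
      have "u l powr (- r) / r + u l - (1 + 1 / r) \<le> g (u l) * (u l - 1)\<^sup>2"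
        using delay_plus_staffing_quadratic(2)[OF elim(1) r] unfolding g
        by (simp add: power2_eq_square ac_simps)
      then show ?case
        using elim by (simp add: divide_right_mono)
    qed
    show "((\<lambda>l. g (u l) * ((u l - 1)\<^sup>2 / w l)) \<longlongrightarrow> 0) F"
      using tendsto_mult[OF isCont_tendsto_compose[OF g(2) u] quad] by simp
  qed simp
  have prod: "((\<lambda>l. u l * w l * e l) \<longlongrightarrow> 1 * 0 * k) F"
    by (intro tendsto_intros u w e)
  have "((\<lambda>l. u l powr (- r) / r * (u l * e l / (1 + u l * w l * e l))) \<longlongrightarrow> 1 powr (- r) / r * (1 * k / (1 + 1 * 0 * k))) F"
    by (intro tendsto_intros u e prod) (use r in auto)
  with excess have "((\<lambda>l. (u l powr (- r) / r + u l - (1 + 1 / r)) / w l - u l powr (- r) / r * (u l * e l / (1 + u l * w l * e l)))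
     \<longlongrightarrow> 0 - 1 powr (- r) / r * (1 * k / (1 + 1 * 0 * k))) F"
    by (rule tendsto_diff)
  moreover have "eventually (\<lambda>l. 1 + u l * w l * e l > 0) F"
    using order_tendstoD(1)[OF prod, of "-1"] by (auto elim!: eventually_mono)
  then have "eventually (\<lambda>l. (u l powr (- r) / r + u l - (1 + 1 / r)) / w l - u l powr (- r) / r * (u l * e l / (1 + u l * w l * e l))
     = (u l powr (- r) / r * (1 / (1 + u l * w l * e l)) + u l - (1 + 1 / r)) / w l) F"
    using wpos
  proof eventually_elim
    case (elim l)
    have "1 - 1 / (1 + u l * w l * e l) = u l * w l * e l / (1 + u l * w l * e l)"
      using elim(1) by (simp add: diff_divide_eq_iff)
    then have "u l * e l / (1 + u l * w l * e l) = (1 - 1 / (1 + u l * w l * e l)) / w l"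
      using elim(2) by simp
    then show ?case
      by (simp only:) (simp add: diff_divide_distrib add_divide_distrib right_diff_distrib)
  qed
  ultimately show ?thesis
    by (auto intro: Lim_transform_eventually)
qed

section \<open>Normalizing the staffing problem\<close>

text \<open>
  The minimizer of the cost over real excess capacities if the probability of waiting were \<open>1\<close>.
\<close>
definition fluid_excess :: "real \<Rightarrow> real \<Rightarrow> real \<Rightarrow> real \<Rightarrow> real \<Rightarrow> real" where
  "fluid_excess h c \<mu> r lam = sigma_star h c \<mu> r * (lam / \<mu>) powr (1 / (r + 1))"

lemma sigma_star_pos:
  assumes "h > 0" "c > 0" "\<mu> > 0" "r > 1"
  shows "sigma_star h c \<mu> r > 0"
proof -
  have "Gamma (r + 1) \<noteq> 0" using Gamma_real_pos[of "r + 1"] assms by linarith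
  then show ?thesis using assms by (simp add: sigma_star_def)
qed

lemma fluid_excess_pos:
  assumes "h > 0" "c > 0" "\<mu> > 0" "r > 1" "lam > 0"
  shows "fluid_excess h c \<mu> r lam > 0"
  using assms sigma_star_pos[of h c \<mu> r] by (simp add: fluid_excess_def)

text \<open>The first-order condition that defines the minimizer.\<close>
lemma fluid_excess_powr:
  assumes "h > 0" "c > 0" "\<mu> > 0" "r > 1" "lam > 0"
  shows "fluid_excess h c \<mu> r lam powr (r + 1) = r / c * (h * Gamma (r + 1) * \<mu> powr (- r)) * lam"
proof -
  have "fluid_excess h c \<mu> r lam powr (r + 1) = h / c * r * Gamma (r + 1) * \<mu> powr (1 - r) * (lam / \<mu>)"
    using assms sigma_star_pos[of h c \<mu> r] Gamma_real_pos[of "r + 1"]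
    by (simp add: fluid_excess_def powr_mult powr_powr sigma_star_def)
  moreover have "\<mu> powr (1 - r) = \<mu> powr (- r) * \<mu>"
    using assms powr_add[of \<mu> "- r" 1] by simp
  ultimately show ?thesis using assms by (simp add: field_simps)
qed

text \<open>
  In units of \<open>y\<close> all model parameters except \<open>r\<close> disappear from the shape of the cost: the
  first-order condition turns the coefficient of the delay term into \<open>c * y / r\<close>.
\<close>
lemma staffing_cost_normalized:
  fixes h c \<mu> r lam u :: real
  defines "a \<equiv> lam / \<mu>" and "y \<equiv> fluid_excess h c \<mu> r lam"
  assumes pos: "h > 0" "c > 0" "\<mu> > 0" "r > 1" "lam > 0" and "u > 0"
  shows "staffing_cost h c \<mu> r lam (a + u * y) =
     c * a + c * y * (u powr (- r) / r * (1 / (1 + u * y * exp_powr_integral a (a + u * y - 1))) + u)"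
proof -
  have a: "a > 0" "a * \<mu> = lam" using pos by (auto simp: a_def)
  have y: "y > 0" using fluid_excess_pos[OF pos] by (simp add: y_def)
  have uy: "u * y > 0" using y assms by simp
  define C where "C = erlang_C (lam / ((a + u * y) * \<mu>)) (a + u * y)"
  have C: "C = 1 / (1 + u * y * exp_powr_integral a (a + u * y - 1))"
    unfolding C_def
  proof (rule erlang_C_eq)
    have "a + u * y > 0" using a uy by simp
    then show "(a + u * y) * (lam / ((a + u * y) * \<mu>)) = a"
      by (simp add: a_def)
  qed (use a in auto)
  have "(a + u * y) * \<mu> - lam = \<mu> * (u * y)"
    using a by (simp add: algebra_simps)
  then have "h * lam * wait_moment \<mu> r lam (a + u * y) = h * lam * (Gamma (r + 1) / (\<mu> * (u * y)) powr r) * C"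
    by (simp add: wait_moment_def C_def)
  also have "h * lam * (Gamma (r + 1) / (\<mu> * (u * y)) powr r) =
     h * Gamma (r + 1) * \<mu> powr (- r) * lam * (u powr (- r) * y powr (- r))"
    using pos y assms by (simp add: powr_mult powr_minus field_simps)
  also have "h * Gamma (r + 1) * \<mu> powr (- r) * lam = c / r * y powr (r + 1)"
    unfolding y_def fluid_excess_powr[OF pos] using pos by (simp add: field_simps)
  also have "c / r * y powr (r + 1) * (u powr (- r) * y powr (- r)) = c * y * (u powr (- r) / r)"
    using y powr_add[of y "r + 1" "- r"] by (simp add: field_simps)
  finally show ?thesis
    unfolding staffing_cost_def C[symmetric] by (simp add: algebra_simps)
qed

text \<open>
  Monotonicity of the integral in the excess capacity gives one discount parameter
  \<open>y * exp_powr_integral a (a + 2 * y - 1)\<close> that serves for all staffing levels up to \<open>a + 2 * y\<close>;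
  higher levels are too expensive anyway.  The bound is therefore uniform in \<open>s\<close>.
\<close>
lemma staffing_cost_ge_relaxed_minimum:
  fixes h c \<mu> r lam s :: real
  defines "a \<equiv> lam / \<mu>" and "y \<equiv> fluid_excess h c \<mu> r lam"
  assumes pos: "h > 0" "c > 0" "\<mu> > 0" "r > 1" "lam > 0" and "s > a"
    and j: "y * exp_powr_integral a (a + 2 * y - 1) < 1"
  shows "c * a + c * y * ((1 + 1 / r) * (1 - y * exp_powr_integral a (a + 2 * y - 1)) powr (1 / (r + 1)))
    \<le> staffing_cost h c \<mu> r lam s"
proof -
  have a: "a > 0" using pos by (auto simp: a_def)
  have y: "y > 0" using fluid_excess_pos[OF pos] by (simp add: y_def)
  define u where "u = (s - a) / y"
  have u: "u > 0" "s = a + u * y" using y \<open>s > a\<close> by (auto simp: u_def)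
  define E where "E = exp_powr_integral a (a + u * y - 1)"
  have uyE: "u * y * E \<ge> 0"
    using u y by (simp add: E_def exp_powr_integral_nonneg)
  have "(1 + 1 / r) * (1 - y * exp_powr_integral a (a + 2 * y - 1)) powr (1 / (r + 1))
    \<le> u powr (- r) / r * (1 / (1 + u * y * E)) + u"
  proof (rule busy_delay_plus_staffing_ge)
    assume "u \<le> 2"
    then have "E \<le> exp_powr_integral a (a + 2 * y - 1)"
      unfolding E_def using a y by (intro exp_powr_integral_mono) auto
    then have "u * y * E \<le> u * y * exp_powr_integral a (a + 2 * y - 1)"
      using u y by (intro mult_left_mono) auto
    moreover have "1 - v \<le> 1 / (1 + v)" if "v \<ge> 0" for v :: real
      using that by (simp add: field_simps)
    then have "1 - u * y * E \<le> 1 / (1 + u * y * E)"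
      using uyE .
    ultimately show "1 - u * (y * exp_powr_integral a (a + 2 * y - 1)) \<le> 1 / (1 + u * y * E)"
      by (simp add: mult.assoc)
  qed (use u pos y j uyE in \<open>auto simp: exp_powr_integral_nonneg\<close>)
  then have "c * y * ((1 + 1 / r) * (1 - y * exp_powr_integral a (a + 2 * y - 1)) powr (1 / (r + 1)))
    \<le> c * y * (u powr (- r) / r * (1 / (1 + u * y * E)) + u)"
    using pos y by (intro mult_left_mono) auto
  then show ?thesis
    using staffing_cost_normalized[OF pos u(1)] u(2) by (simp add: a_def y_def E_def)
qed

section \<open>Expansion of the costs on the gap scale\<close>

text \<open>The minimal cost over real staffing levels if the probability of waiting were \<open>1\<close>.\<close>
definition fluid_cost :: "real \<Rightarrow> real \<Rightarrow> real \<Rightarrow> real \<Rightarrow> real \<Rightarrow> real" where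
  "fluid_cost h c \<mu> r lam = c * (lam / \<mu>) + c * fluid_excess h c \<mu> r lam * (1 + 1 / r)"

text \<open>Near the minimizer, the probability of not having to wait is asymptotically a constant multiple of
  this ratio, which is the small parameter of all expansions below.\<close>
definition excess_ratio :: "real \<Rightarrow> real \<Rightarrow> real \<Rightarrow> real \<Rightarrow> real \<Rightarrow> real" where
  "excess_ratio h c \<mu> r lam = fluid_excess h c \<mu> r lam / sqrt (lam / \<mu>)"

lemma excess_ratio_pos:
  assumes "h > 0" "c > 0" "\<mu> > 0" "r > 1" "lam > 0"
  shows "excess_ratio h c \<mu> r lam > 0"
  using fluid_excess_pos[OF assms] assms by (simp add: excess_ratio_def)

lemma excess_ratio_eq:
  assumes "\<mu> > 0" "r > 1" "lam > 0"
  shows "excess_ratio h c \<mu> r lam = sigma_star h c \<mu> r * (lam / \<mu>) powr (1 / (r + 1) - 1 / 2)"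
  using assms by (simp add: excess_ratio_def fluid_excess_def powr_diff powr_half_sqrt)

text \<open>
  The gap scale is exactly the order of the saving from customers who do not wait: a fraction
  \<open>excess_ratio\<close> of a delay cost of order \<open>fluid_excess\<close>.
\<close>
lemma fluid_excess_times_ratio:
  assumes "\<mu> > 0" "r > 1" "lam > 0"
  shows "fluid_excess h c \<mu> r lam * excess_ratio h c \<mu> r lam =
    (sigma_star h c \<mu> r)\<^sup>2 / \<mu> powr ((3 - r) / (2 * (1 + r))) * gap_scale r lam"
proof -
  have "1 / (r + 1) = 2 / (2 * (1 + r))" "1 / 2 = (1 + r) / (2 * (1 + r))"
    using assms by (simp_all add: add.commute del: distrib_left_numeral)
  then have "1 / (r + 1) + (1 / (r + 1) - 1 / 2) = (2 + (2 - (1 + r))) / (2 * (1 + r))"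
    by (simp only: add_divide_distrib diff_divide_distrib)
  then have "1 / (r + 1) + (1 / (r + 1) - 1 / 2) = (3 - r) / (2 * (1 + r))"
    by simp
  then have powers: "(lam / \<mu>) powr (1 / (r + 1)) * (lam / \<mu>) powr (1 / (r + 1) - 1 / 2) =
      gap_scale r lam / \<mu> powr ((3 - r) / (2 * (1 + r)))"
    using assms unfolding powr_add[symmetric] by (simp add: gap_scale_def powr_divide)
  have "fluid_excess h c \<mu> r lam * excess_ratio h c \<mu> r lam = (sigma_star h c \<mu> r)\<^sup>2 *
      ((lam / \<mu>) powr (1 / (r + 1)) * (lam / \<mu>) powr (1 / (r + 1) - 1 / 2))"
    unfolding excess_ratio_eq[OF assms] fluid_excess_def power2_eq_square by (simp only: ac_simps)
  then show ?thesis
    unfolding powers by simp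
qed

lemma excess_ratio_tendsto_0:
  assumes "\<mu> > 0" "r > 1"
  shows "((\<lambda>lam. excess_ratio h c \<mu> r lam) \<longlongrightarrow> 0) at_top"
proof -
  have "1 / (r + 1) - 1 / 2 < 0" using assms by (simp add: field_simps)
  then have "((\<lambda>lam. (lam / \<mu>) powr (1 / (r + 1) - 1 / 2)) \<longlongrightarrow> 0) at_top"
    using assms(1) by real_asymp
  then have "((\<lambda>lam. sigma_star h c \<mu> r * (lam / \<mu>) powr (1 / (r + 1) - 1 / 2)) \<longlongrightarrow> 0) at_top"
    by (rule tendsto_mult_right_zero)
  then show ?thesis
    by (rule Lim_transform_eventually)
      (use eventually_gt_at_top[of 0] in eventually_elim, simp add: excess_ratio_eq assms)
qed

text \<open>Converts costs normalized by \<open>excess_ratio\<close> into units of the gap scale.\<close>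
definition gap_factor :: "real \<Rightarrow> real \<Rightarrow> real \<Rightarrow> real \<Rightarrow> real" where
  "gap_factor h c \<mu> r = c * (sigma_star h c \<mu> r)\<^sup>2 / \<mu> powr ((3 - r) / (2 * (1 + r)))"

lemma normalized_gap:
  assumes pos: "h > 0" "c > 0" "\<mu> > 0" "r > 1" "lam > 0"
  shows "(c * (lam / \<mu>) + c * fluid_excess h c \<mu> r lam * z - fluid_cost h c \<mu> r lam) / gap_scale r lam
    = gap_factor h c \<mu> r * ((z - (1 + 1 / r)) / excess_ratio h c \<mu> r lam)"
proof -
  let ?y = "fluid_excess h c \<mu> r lam" and ?w = "excess_ratio h c \<mu> r lam"
  have w: "?w > 0" using fluid_excess_pos[OF pos] pos by (simp add: excess_ratio_def)
  have n: "gap_scale r lam > 0" using pos by (simp add: gap_scale_def)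
  have "c * (?y * ?w) = gap_factor h c \<mu> r * gap_scale r lam"
    unfolding fluid_excess_times_ratio[OF pos(3-5)] gap_factor_def by simp
  then have "c * ?y / gap_scale r lam = gap_factor h c \<mu> r / ?w"
    using w n by (simp add: field_simps)
  moreover have "(c * (lam / \<mu>) + c * ?y * z - fluid_cost h c \<mu> r lam) / gap_scale r lam
     = c * ?y / gap_scale r lam * (z - (1 + 1 / r))"
    by (simp add: fluid_cost_def algebra_simps diff_divide_distrib add_divide_distrib)
  ultimately show ?thesis by simp
qed

lemma exp_powr_integral_near_fluid_excess:
  assumes pos: "h > 0" "c > 0" "\<mu> > 0" "r > 1" and u: "(u \<longlongrightarrow> u0) at_top"
  shows "((\<lambda>lam. sqrt (lam / \<mu>) * exp_powr_integral (lam / \<mu>) (lam / \<mu> + u lam * fluid_excess h c \<mu> r lam - 1))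
     \<longlongrightarrow> gauss_const) at_top"
proof (rule exp_powr_integral_asymptotics[where A = "\<lambda>lam. lam / \<mu>" and X = "\<lambda>lam. u lam * fluid_excess h c \<mu> r lam"])
  show "filterlim (\<lambda>lam. lam / \<mu>) at_top at_top"
    using pos(3) by real_asymp
  have "((\<lambda>lam. u lam * excess_ratio h c \<mu> r lam) \<longlongrightarrow> u0 * 0) at_top"
    by (rule tendsto_mult[OF u excess_ratio_tendsto_0[OF pos(3,4)]])
  then show "((\<lambda>lam. u lam * fluid_excess h c \<mu> r lam / sqrt (lam / \<mu>)) \<longlongrightarrow> 0) at_top"
    by (simp add: excess_ratio_def)
qed

text \<open>
  The optimum over the admissible levels, being an infimum, inherits the uniform lower bound.  An upper
  bound of the same order can fail for \<open>r \<ge> 5\<close>, as rounding may then cost as much as the gap scale or more.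
\<close>
lemma optimal_cost_expansion_ge:
  assumes pos: "h > 0" "c > 0" "\<mu> > 0" "r > 1"
  obtains L where "(L \<longlongrightarrow> - gap_factor h c \<mu> r * gauss_const / r) at_top"
    "eventually (\<lambda>lam. L lam \<le> (optimal_cost h c \<mu> r lam - fluid_cost h c \<mu> r lam) / gap_scale r lam) at_top"
proof -
  define y where "y = fluid_excess h c \<mu> r"
  define w where "w = excess_ratio h c \<mu> r"
  define e where "e = (\<lambda>lam. sqrt (lam / \<mu>) * exp_powr_integral (lam / \<mu>) (lam / \<mu> + 2 * y lam - 1))"
  define z where "z = (\<lambda>lam. (1 + 1 / r) * (1 - w lam * e lam) powr (1 / (r + 1)))"
  have w: "(w \<longlongrightarrow> 0) at_top"
    using excess_ratio_tendsto_0[OF pos(3,4)] by (simp add: w_def)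
  have e: "(e \<longlongrightarrow> gauss_const) at_top"
    using exp_powr_integral_near_fluid_excess[OF pos tendsto_const[of 2]] by (simp add: e_def y_def)
  have lim: "((\<lambda>lam. (z lam - (1 + 1 / r)) / w lam) \<longlongrightarrow> - gauss_const / r) at_top"
    unfolding z_def
  proof (rule relaxed_minimum_expansion)
    show "eventually (\<lambda>lam. w lam > 0) at_top"
      using eventually_gt_at_top[of 0] by eventually_elim (simp add: w_def excess_ratio_pos pos)
  qed (use pos w e in auto)
  show ?thesis
  proof (rule that)
    show "((\<lambda>lam. gap_factor h c \<mu> r * ((z lam - (1 + 1 / r)) / w lam)) \<longlongrightarrow> - gap_factor h c \<mu> r * gauss_const / r) at_top"
      using tendsto_mult_left[OF lim, of "gap_factor h c \<mu> r"] by simp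
    have "((\<lambda>lam. w lam * e lam) \<longlongrightarrow> 0) at_top"
      using tendsto_mult[OF w e] by simp
    then have "eventually (\<lambda>lam. w lam * e lam < 1) at_top"
      by (rule order_tendstoD) simp
    then show "eventually (\<lambda>lam. gap_factor h c \<mu> r * ((z lam - (1 + 1 / r)) / w lam)
        \<le> (optimal_cost h c \<mu> r lam - fluid_cost h c \<mu> r lam) / gap_scale r lam) at_top"
      using eventually_gt_at_top[of 0]
    proof eventually_elim
      case (elim lam)
      have we: "w lam * e lam = y lam * exp_powr_integral (lam / \<mu>) (lam / \<mu> + 2 * y lam - 1)"
        using elim pos by (simp add: w_def e_def excess_ratio_def y_def)
      have "c * (lam / \<mu>) + c * y lam * z lam \<le> optimal_cost h c \<mu> r lam"
        unfolding optimal_cost_def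
      proof (rule cINF_greatest[OF staffing_levels_nonempty])
        fix s assume "s \<in> staffing_levels \<mu> lam"
        then show "c * (lam / \<mu>) + c * y lam * z lam \<le> staffing_cost h c \<mu> r lam s"
          using staffing_cost_ge_relaxed_minimum[OF pos elim(2), of s] elim(1)
          unfolding z_def we by (simp add: y_def staffing_levels_def)
      qed
      then have "(c * (lam / \<mu>) + c * y lam * z lam - fluid_cost h c \<mu> r lam) / gap_scale r lam
         \<le> (optimal_cost h c \<mu> r lam - fluid_cost h c \<mu> r lam) / gap_scale r lam"
        by (intro divide_right_mono) (auto simp: gap_scale_def)
      then show ?case
        unfolding y_def normalized_gap[OF pos elim(2)] w_def .
    qed
  qed
qed

text \<open>
  The condition on \<open>\<eta>\<close> says precisely that, in normalized units, the squared displacement from the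
  minimizer is negligible against \<open>excess_ratio\<close>.  The limit agrees with that of the lower bound on the
  optimal cost.
\<close>
lemma staffing_cost_expansion:
  assumes pos: "h > 0" "c > 0" "\<mu> > 0" "r > 1"
    and \<eta>: "\<eta> \<in> o[at_top](\<lambda>lam. sqrt (gap_scale r lam * lam powr (1 / (1 + r))))"
  shows "((\<lambda>lam. (staffing_cost h c \<mu> r lam (s_bar h c \<mu> r lam + \<eta> lam) - fluid_cost h c \<mu> r lam) / gap_scale r lam)
    \<longlongrightarrow> - gap_factor h c \<mu> r * gauss_const / r) at_top"
proof -
  define y where "y = fluid_excess h c \<mu> r"
  define w where "w = excess_ratio h c \<mu> r"
  define u where "u = (\<lambda>lam. 1 + \<eta> lam / y lam)"
  define e where "e = (\<lambda>lam. sqrt (lam / \<mu>) * exp_powr_integral (lam / \<mu>) (lam / \<mu> + u lam * y lam - 1))"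
  define z where "z = (\<lambda>lam. u lam powr (- r) / r * (1 / (1 + u lam * w lam * e lam)) + u lam)"
  (* The constant in y\<^sup>2 * w = \<kappa> * (gap_scale r lam * lam powr (1 / (1 + r))). *)
  define \<kappa> where "\<kappa> = (sigma_star h c \<mu> r) ^ 3 / (\<mu> powr (1 / (r + 1)) * \<mu> powr ((3 - r) / (2 * (1 + r))))"
  have wpos: "eventually (\<lambda>lam. w lam > 0) at_top"
    using eventually_gt_at_top[of 0] by eventually_elim (simp add: w_def excess_ratio_pos pos)
  have w: "(w \<longlongrightarrow> 0) at_top"
    using excess_ratio_tendsto_0[OF pos(3,4)] by (simp add: w_def)
  have "((\<lambda>lam. \<eta> lam / sqrt (gap_scale r lam * lam powr (1 / (1 + r)))) \<longlongrightarrow> 0) at_top"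
    using smalloD_tendsto[OF \<eta>] .
  then have "((\<lambda>lam. (\<eta> lam / sqrt (gap_scale r lam * lam powr (1 / (1 + r))))\<^sup>2 / \<kappa>) \<longlongrightarrow> 0\<^sup>2 / \<kappa>) at_top"
    by (intro tendsto_intros) (use pos sigma_star_pos[OF pos] in \<open>auto simp: \<kappa>_def\<close>)
  moreover have "eventually (\<lambda>lam. (\<eta> lam / sqrt (gap_scale r lam * lam powr (1 / (1 + r))))\<^sup>2 / \<kappa> = (u lam - 1)\<^sup>2 / w lam) at_top"
    using eventually_gt_at_top[of 0]
  proof eventually_elim
    case (elim lam)
    have "(y lam)\<^sup>2 * w lam = y lam * (y lam * w lam)"
      by (simp add: power2_eq_square)
    also have "\<dots> = \<kappa> * (gap_scale r lam * lam powr (1 / (1 + r)))"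
      unfolding y_def w_def fluid_excess_times_ratio[OF pos(3,4) elim]
      using pos elim
      by (simp add: fluid_excess_def \<kappa>_def powr_divide power2_eq_square power3_eq_cube add.commute[of r 1])
    finally have *: "(y lam)\<^sup>2 * w lam = \<kappa> * (gap_scale r lam * lam powr (1 / (1 + r)))" .
    have "gap_scale r lam * lam powr (1 / (1 + r)) \<ge> 0"
      by (simp add: gap_scale_def)
    then have "(\<eta> lam / sqrt (gap_scale r lam * lam powr (1 / (1 + r))))\<^sup>2 / \<kappa> = (\<eta> lam)\<^sup>2 / ((y lam)\<^sup>2 * w lam)"
      unfolding * by (simp add: power_divide mult.commute)
    then show ?case by (simp add: u_def power_divide)
  qed
  ultimately have quad: "((\<lambda>lam. (u lam - 1)\<^sup>2 / w lam) \<longlongrightarrow> 0) at_top"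
    by (auto intro: Lim_transform_eventually)
  (* Since w tends to 0, the quadratic condition already forces u to tend to 1. *)
  have "((\<lambda>lam. (u lam - 1)\<^sup>2 / w lam * w lam) \<longlongrightarrow> 0 * 0) at_top"
    by (intro tendsto_intros quad w)
  then have "((\<lambda>lam. (u lam - 1)\<^sup>2) \<longlongrightarrow> 0 * 0) at_top"
    by (rule Lim_transform_eventually) (use wpos in eventually_elim, simp)
  then have "((\<lambda>lam. u lam - 1) \<longlongrightarrow> 0) at_top"
    by simp
  then have u: "(u \<longlongrightarrow> 1) at_top"
    by (simp add: LIM_zero_iff)
  have e: "(e \<longlongrightarrow> gauss_const) at_top"
    unfolding e_def y_def by (rule exp_powr_integral_near_fluid_excess[OF pos u])
  have lim: "((\<lambda>lam. (z lam - (1 + 1 / r)) / w lam) \<longlongrightarrow> - gauss_const / r) at_top"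
    unfolding z_def by (rule normalized_cost_expansion) (use pos w e wpos u quad in auto)
  have "((\<lambda>lam. gap_factor h c \<mu> r * ((z lam - (1 + 1 / r)) / w lam)) \<longlongrightarrow> - gap_factor h c \<mu> r * gauss_const / r) at_top"
    using tendsto_mult_left[OF lim, of "gap_factor h c \<mu> r"] by simp
  moreover have "eventually (\<lambda>lam. gap_factor h c \<mu> r * ((z lam - (1 + 1 / r)) / w lam) =
      (staffing_cost h c \<mu> r lam (s_bar h c \<mu> r lam + \<eta> lam) - fluid_cost h c \<mu> r lam) / gap_scale r lam) at_top"
    using eventually_gt_at_top[of 0] order_tendstoD(1)[OF u zero_less_one]
  proof eventually_elim
    case (elim lam)
    have y: "y lam > 0" using fluid_excess_pos[OF pos elim(1)] by (simp add: y_def)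
    then have "u lam * y lam = y lam + \<eta> lam"
      by (simp add: u_def distrib_right)
    then have level: "s_bar h c \<mu> r lam + \<eta> lam = lam / \<mu> + u lam * y lam"
      by (simp add: s_bar_def y_def fluid_excess_def)
    have uwe: "u lam * w lam * e lam = u lam * y lam * exp_powr_integral (lam / \<mu>) (lam / \<mu> + u lam * y lam - 1)"
      using elim pos by (simp add: w_def e_def excess_ratio_def y_def)
    have "staffing_cost h c \<mu> r lam (s_bar h c \<mu> r lam + \<eta> lam) = c * (lam / \<mu>) + c * y lam * z lam"
      unfolding level z_def uwe unfolding y_def by (rule staffing_cost_normalized[OF pos elim])
    then show ?case
      unfolding y_def w_def by (simp only: normalized_gap[OF pos elim(1)])
  qed
  ultimately show ?thesis
    by (rule Lim_transform_eventually)
qed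

text \<open>
  For \<open>r < 5\<close> the admissible deviations include all bounded ones, in particular rounding to an integer.
\<close>
lemma deviation_scale_at_top:
  fixes r :: real
  assumes "r > 1" "r < 5"
  shows "filterlim (\<lambda>lam. sqrt (gap_scale r lam * lam powr (1 / (1 + r)))) at_top at_top"
proof -
  have "(3 - r) / (2 * (1 + r)) + 1 / (1 + r) = ((3 - r) + 2) / (2 * (1 + r))"
    by (subst add_divide_distrib) (simp del: distrib_left_numeral)
  then have "(3 - r) / (2 * (1 + r)) + 1 / (1 + r) = (5 - r) / (2 * (1 + r))"
    by simp
  moreover have "filterlim (\<lambda>x. sqrt (x powr q)) at_top at_top" if "q > 0" for q :: real
    using that by real_asymp
  then have "filterlim (\<lambda>x. sqrt (x powr ((5 - r) / (2 * (1 + r))))) at_top at_top"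
    using assms by simp
  ultimately show ?thesis
    unfolding gap_scale_def powr_add[symmetric] by simp
qed

theorem proposition4:
  fixes h c \<mu> r :: real and \<eta> :: "real \<Rightarrow> real"
  assumes "h > 0" and "c > 0" and "\<mu> > 0" and "r > 1"
    and "\<eta> \<in> o[at_top](\<lambda>lam. sqrt (gap_scale r lam * lam powr (1 / (1 + r))))"
  shows
    "(r < 5 \<longrightarrow>
       ((\<lambda>lam. optimality_gap h c \<mu> r lam (s_bar h c \<mu> r lam + \<eta> lam) / gap_scale r lam)
         \<longlongrightarrow> 0) at_top)
     \<and> ((\<lambda>lam. optimality_gap h c \<mu> r lam (s_bar h c \<mu> r lam + \<eta> lam) / gap_scale r lam)
         \<longlongrightarrow> 0)
         (inf at_top (principal {lam. s_bar h c \<mu> r lam + \<eta> lam \<in> staffing_levels \<mu> lam}))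
     \<and> ((\<lambda>lam. max 0 (optimality_gap h c \<mu> r lam (s_bar h c \<mu> r lam + \<eta> lam)) / gap_scale r lam)
         \<longlongrightarrow> 0) at_top"
proof -
  note pos = assms(1-4)
  define gap where "gap = (\<lambda>lam. optimality_gap h c \<mu> r lam (s_bar h c \<mu> r lam + \<eta> lam))"
  define cost where "cost = (\<lambda>\<eta> lam. (staffing_cost h c \<mu> r lam (s_bar h c \<mu> r lam + \<eta> lam) - fluid_cost h c \<mu> r lam) / gap_scale r lam)"
  define opt where "opt = (\<lambda>lam. (optimal_cost h c \<mu> r lam - fluid_cost h c \<mu> r lam) / gap_scale r lam)"
  define lim where "lim = - gap_factor h c \<mu> r * gauss_const / r"
  have scale: "gap_scale r lam \<ge> 0" for lam
    by (simp add: gap_scale_def)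
  have gap_eq: "gap lam / gap_scale r lam = cost \<eta> lam - opt lam" for lam
    by (simp add: gap_def cost_def opt_def optimality_gap_def diff_divide_distrib)
  have cost: "(cost \<eta> \<longlongrightarrow> lim) at_top"
    if "\<eta> \<in> o[at_top](\<lambda>lam. sqrt (gap_scale r lam * lam powr (1 / (1 + r))))" for \<eta>
    unfolding cost_def lim_def by (rule staffing_cost_expansion[OF pos that])
  obtain L where L: "(L \<longlongrightarrow> lim) at_top" "eventually (\<lambda>lam. L lam \<le> opt lam) at_top"
    unfolding lim_def opt_def by (rule optimal_cost_expansion_ge[OF pos])
  have opt_le: "optimal_cost h c \<mu> r lam \<le> staffing_cost h c \<mu> r lam s"
    if "s \<in> staffing_levels \<mu> lam" "lam > 0" for s lam
    unfolding optimal_cost_def using that by (intro cINF_lower bdd_below_staffing_cost pos)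
  have upper: "((\<lambda>lam. cost \<eta> lam - L lam) \<longlongrightarrow> 0) at_top"
    using tendsto_diff[OF cost[OF assms(5)] L(1)] by simp
  have pos_part: "((\<lambda>lam. max 0 (gap lam) / gap_scale r lam) \<longlongrightarrow> 0) at_top"
  proof (rule tendsto_sandwich)
    show "eventually (\<lambda>lam. 0 \<le> max 0 (gap lam) / gap_scale r lam) at_top"
      using scale by simp
    show "eventually (\<lambda>lam. max 0 (gap lam) / gap_scale r lam \<le> max 0 (cost \<eta> lam - L lam)) at_top"
      using L(2)
    proof eventually_elim
      case (elim lam)
      have "max 0 (gap lam) / gap_scale r lam = max 0 (cost \<eta> lam - opt lam)"
        using scale[of lam] by (auto simp: gap_eq[symmetric] max_def zero_le_divide_iff divide_le_0_iff)
      then show ?case using elim by simp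
    qed
    show "((\<lambda>lam. max 0 (cost \<eta> lam - L lam)) \<longlongrightarrow> 0) at_top"
      using tendsto_max[OF tendsto_const[of 0] upper] by simp
  qed simp
  (* At an admissible level the gap is nonnegative, so it equals its positive part. *)
  have integral_levels: "((\<lambda>lam. gap lam / gap_scale r lam) \<longlongrightarrow> 0)
    (inf at_top (principal {lam. s_bar h c \<mu> r lam + \<eta> lam \<in> staffing_levels \<mu> lam}))"
  proof (rule Lim_transform_eventually)
    show "((\<lambda>lam. max 0 (gap lam) / gap_scale r lam) \<longlongrightarrow> 0)
      (inf at_top (principal {lam. s_bar h c \<mu> r lam + \<eta> lam \<in> staffing_levels \<mu> lam}))"
      using pos_part by (rule tendsto_mono[rotated]) simp
    show "eventually (\<lambda>lam. max 0 (gap lam) / gap_scale r lam = gap lam / gap_scale r lam)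
      (inf at_top (principal {lam. s_bar h c \<mu> r lam + \<eta> lam \<in> staffing_levels \<mu> lam}))"
      unfolding eventually_inf_principal using eventually_gt_at_top[of 0]
      by eventually_elim (use opt_le in \<open>auto simp: gap_def optimality_gap_def\<close>)
  qed
  (* Rounding s_bar up is itself an admissible deviation and bounds the optimal cost from above. *)
  have small_r: "((\<lambda>lam. gap lam / gap_scale r lam) \<longlongrightarrow> 0) at_top" if "r < 5"
  proof -
    define \<eta>' where "\<eta>' = (\<lambda>lam. of_int \<lceil>s_bar h c \<mu> r lam\<rceil> - s_bar h c \<mu> r lam)"
    have \<eta>'_bound: "0 \<le> \<eta>' lam" "\<eta>' lam \<le> 1" for lam
      unfolding \<eta>'_def by linarith+
    have "\<eta>' \<in> o[at_top](\<lambda>lam. sqrt (gap_scale r lam * lam powr (1 / (1 + r))))"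
    proof (rule landau_o.big_small_trans)
      show "\<eta>' \<in> O[at_top](\<lambda>_. 1 :: real)"
        using \<eta>'_bound by (intro bigoI[of _ 1]) auto
      show "(\<lambda>_. 1 :: real) \<in> o[at_top](\<lambda>lam. sqrt (gap_scale r lam * lam powr (1 / (1 + r))))"
      proof (rule smalloI_tendsto)
        note top = deviation_scale_at_top[OF pos(4) that]
        show "((\<lambda>lam. 1 / sqrt (gap_scale r lam * lam powr (1 / (1 + r)))) \<longlongrightarrow> 0) at_top"
          by (rule tendsto_divide_0[OF tendsto_const filterlim_at_top_imp_at_infinity[OF top]])
        have "eventually (\<lambda>lam. sqrt (gap_scale r lam * lam powr (1 / (1 + r))) > 0) at_top"
          using top unfolding filterlim_at_top_dense by blast
        then show "eventually (\<lambda>lam. sqrt (gap_scale r lam * lam powr (1 / (1 + r))) \<noteq> 0) at_top"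
          by (rule eventually_mono) linarith
      qed
    qed
    then have lower: "((\<lambda>lam. cost \<eta> lam - cost \<eta>' lam) \<longlongrightarrow> 0) at_top"
      using tendsto_diff[OF cost[OF assms(5)] cost] by simp
    show ?thesis
    proof (rule tendsto_sandwich[OF _ _ lower pos_part])
      show "eventually (\<lambda>lam. cost \<eta> lam - cost \<eta>' lam \<le> gap lam / gap_scale r lam) at_top"
        using eventually_gt_at_top[of 0]
      proof eventually_elim
        case (elim lam)
        have "s_bar h c \<mu> r lam > lam / \<mu>"
          using fluid_excess_pos[OF pos elim] by (simp add: s_bar_def fluid_excess_def)
        moreover have "lam / \<mu> > 0" using elim pos by simp
        ultimately have "\<lceil>s_bar h c \<mu> r lam\<rceil> \<ge> 0" "of_int \<lceil>s_bar h c \<mu> r lam\<rceil> > lam / \<mu>"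
          by linarith+
        moreover from this(1) obtain n where "\<lceil>s_bar h c \<mu> r lam\<rceil> = int n"
          using zero_le_imp_eq_int by blast
        ultimately have "s_bar h c \<mu> r lam + \<eta>' lam \<in> staffing_levels \<mu> lam"
          by (simp add: staffing_levels_def \<eta>'_def)
        then have "opt lam \<le> cost \<eta>' lam"
          unfolding opt_def cost_def using opt_le[OF _ elim] scale
          by (intro divide_right_mono) auto
        then show ?case by (simp add: gap_eq)
      qed
      show "eventually (\<lambda>lam. gap lam / gap_scale r lam \<le> max 0 (gap lam) / gap_scale r lam) at_top"
        using scale by (intro always_eventually allI divide_right_mono) auto
    qed
  qed
  show ?thesis
    using pos_part integral_levels small_r unfolding gap_def by blast
qed

end
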